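(* Let $u(x)$ be smooth in $S_1=I_{0.5}\cup I_{1.5}$ and contain a discontinuity in $I_{2.5}$ with jump $\Delta u$. Further, let the optimal weights be $c_0=K_0h^{\gamma_0}$, $c_1=K_1h^{\gamma_1}$, $c_2=1-K_0h^{\gamma_0}-K_1h^{\gamma_1}$ with $K_0,K_1\in\mathbb{R}_{>0}$ and $\gamma_0,\gamma_1\in\mathbb{R}_{\ge0}$, where $\gamma_0\ge\gamma_1$. Let $$\omega_i=\frac{\alpha_i}{\alpha_0+\alpha_1+\alpha_2},\qquad \alpha_i=\frac{c_i}{(\epsilon(h)+IS_i)^p},\qquad \epsilon(h)=Kh^q,\qquad i\in\{0,1,2\}.$$ Assuming $pq\ge\gamma_1$ and $q\le2$, the weights $\omega_i$ satisfy $$\omega_0=O(h^{\gamma_0-\gamma_1}),\qquad \omega_1=O(1),\qquad \omega_2=O(h^{pq-\gamma_1}).$$ In particular, if the parameters additionally fulfill $\gamma_0\ge1+\gamma_1$ and $pq\ge2+\gamma_1$, then $$\omega_0=O(h),\qquad \omega_1=O(1),\qquad \omega_2=O(h^2).$$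
   Context: Grid: $h>0$ is the mesh size, $x_0\in\mathbb{R}$ the left boundary point, $x_j=x_0+jh$, and for $j\in\{0.5,1.5,2.5\}$ the cells are $I_j=[x_j-\tfrac h2,x_j+\tfrac h2]$. Cell averages: $\bar u_j=\frac1h\int_{I_j}u(x)\,dx$; differences $\sigma_l=\bar u_{1.5}-\bar u_{0.5}$, $\sigma_r=\bar u_{2.5}-\bar u_{1.5}$. Smoothness indicators: $$IS_0=0,\qquad IS_1=\sigma_l^2,\qquad IS_2=\frac1{c_2^2}\Big(\tfrac43\sigma_r^2+\big(c_1-\tfrac{11}3\big)\sigma_r\sigma_l+\big(\tfrac{10}3-3c_1+c_1^2\big)\sigma_l^2\Big).$$ Parameters: $K\in\mathbb{R}_{>0}$, $q\in\mathbb{R}_{>0}$ and $p\in\mathbb{N}$; the optimal weights satisfy $c_i>0$ and $c_0+c_1+c_2=1$. The case considered is that of a single discontinuity in $I_{2.5}$. The $O(\cdot)$ statements are for $h\to0$.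
   Formalization: u and the grid may vary with h; u is smooth off the single discontinuity with derivatives bounded uniformly in h, and the fixed jump Δu is nonzero; the discontinuity stays a fixed fraction of the cell away from the right end of I_{2.5} (at x_3 the averages miss the jump and the ω_2 claim fails). *)

theory Defs
  imports "HOL-Analysis.Analysis" "HOL-Library.Landau_Symbols"
begin

definition grid_pt :: "real \<Rightarrow> real \<Rightarrow> real \<Rightarrow> real" where
  "grid_pt x0 h j = x0 + j * h"

definition cell :: "real \<Rightarrow> real \<Rightarrow> real \<Rightarrow> real set" where
  "cell x0 h j = {grid_pt x0 h j - h / 2 .. grid_pt x0 h j + h / 2}"

definition cell_avg :: "(real \<Rightarrow> real) \<Rightarrow> real \<Rightarrow> real \<Rightarrow> real \<Rightarrow> real" where
  "cell_avg u x0 h j = (1 / h) * integral (cell x0 h j) u"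

definition sigma_l :: "(real \<Rightarrow> real) \<Rightarrow> real \<Rightarrow> real \<Rightarrow> real" where
  "sigma_l u x0 h = cell_avg u x0 h (3/2) - cell_avg u x0 h (1/2)"

definition sigma_r :: "(real \<Rightarrow> real) \<Rightarrow> real \<Rightarrow> real \<Rightarrow> real" where
  "sigma_r u x0 h = cell_avg u x0 h (5/2) - cell_avg u x0 h (3/2)"

text \<open>Indices of weights and indicators are the naturals 0, 1, 2; values at
  larger indices are irrelevant.\<close>

definition IS :: "(nat \<Rightarrow> real) \<Rightarrow> (real \<Rightarrow> real) \<Rightarrow> real \<Rightarrow> real \<Rightarrow> nat \<Rightarrow> real" where
  "IS c u x0 h i =
    (let sl = sigma_l u x0 h; sr = sigma_r u x0 h in
     if i = 0 then 0
     else if i = 1 then sl\<^sup>2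
     else 1 / (c 2)\<^sup>2 *
       (4/3 * sr\<^sup>2 + (c 1 - 11/3) * sr * sl + (10/3 - 3 * c 1 + (c 1)\<^sup>2) * sl\<^sup>2))"

definition alpha :: "(nat \<Rightarrow> real) \<Rightarrow> real \<Rightarrow> nat \<Rightarrow> (real \<Rightarrow> real) \<Rightarrow> real \<Rightarrow> real \<Rightarrow> nat \<Rightarrow> real" where
  "alpha c eps p u x0 h i = c i / (eps + IS c u x0 h i) ^ p"

definition omega :: "(nat \<Rightarrow> real) \<Rightarrow> real \<Rightarrow> nat \<Rightarrow> (real \<Rightarrow> real) \<Rightarrow> real \<Rightarrow> real \<Rightarrow> nat \<Rightarrow> real" where
  "omega c eps p u x0 h i =
    alpha c eps p u x0 h i /
    (alpha c eps p u x0 h 0 + alpha c eps p u x0 h 1 + alpha c eps p u x0 h 2)"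

text \<open>\<open>D k\<close> is a \<open>k\<close>-th derivative of \<open>u\<close> on \<open>S\<close>, one-sided at boundary points of \<open>S\<close>.\<close>

definition derivs_on :: "(nat \<Rightarrow> real \<Rightarrow> real) \<Rightarrow> (real \<Rightarrow> real) \<Rightarrow> real set \<Rightarrow> bool" where
  "derivs_on D u S \<longleftrightarrow>
    (\<forall>x\<in>S. D 0 x = u x) \<and>
    (\<forall>k. \<forall>x\<in>S. (D k has_real_derivative D (Suc k) x) (at x within S))"

text \<open>The cells shrink as \<open>h\<close> tends to 0, and a discontinuity can lie in the third cell for
  all small \<open>h\<close> only if the function or the grid moves with \<open>h\<close>. Smoothness is therefore a
  property of a family \<open>u h\<close> on sets \<open>S h\<close>: every \<open>u h\<close> is infinitely differentiable
  on \<open>S h\<close>, and each derivative is bounded uniformly in \<open>h\<close>. For one fixed \<open>u\<close>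
  this says that \<open>u\<close> does not degenerate as the cells approach the discontinuity.\<close>

definition smooth_family_on :: "(real \<Rightarrow> real set) \<Rightarrow> (real \<Rightarrow> real \<Rightarrow> real) \<Rightarrow> bool" where
  "smooth_family_on S u \<longleftrightarrow>
    (\<exists>D. (\<forall>\<^sub>F h in at_right 0. derivs_on (D h) (u h) (S h)) \<and>
         (\<forall>k. \<exists>M. \<forall>\<^sub>F h in at_right 0. \<forall>x\<in>S h. \<bar>D h k x\<bar> \<le> M))"

definition has_jump :: "(real \<Rightarrow> real) \<Rightarrow> real \<Rightarrow> real \<Rightarrow> bool" where
  "has_jump u \<xi> \<Delta> \<longleftrightarrow>
    (\<exists>l r. (u \<longlongrightarrow> l) (at_left \<xi>) \<and> (u \<longlongrightarrow> r) (at_right \<xi>) \<and> r - l = \<Delta>)"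

end

theory Submission
  imports Defs
begin

text \<open>The weights are compared with \<open>\<alpha>\<^sub>1\<close>. All \<open>\<alpha>\<^sub>i\<close> are positive, so
  \<open>\<omega>\<^sub>i \<le> \<alpha>\<^sub>i / \<alpha>\<^sub>1\<close>, and everything reduces to a lower bound for \<open>\<alpha>\<^sub>1\<close> and an upper
  bound for \<open>\<alpha>\<^sub>2\<close>.

  In the two cells left of the discontinuity \<open>u\<close> has a bounded derivative, hence
  \<open>\<sigma>\<^sub>l = O(h)\<close>. Since \<open>q \<le> 2\<close>, the indicator \<open>\<sigma>\<^sub>l\<^sup>2 = O(h\<^sup>2)\<close> is dominated by \<open>\<epsilon> = K h\<^sup>q\<close>,
  which gives \<open>\<alpha>\<^sub>1 \<ge> const * h powr (\<gamma>1 - p q)\<close>, the same power of \<open>\<epsilon>\<close> as in \<open>\<alpha>\<^sub>0\<close>.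

  In the third cell the average is a convex combination of the one-sided limits at \<open>\<xi>\<close>, up to
  \<open>O(h)\<close>; the weight of the right limit is the fraction of the cell that lies right of
  \<open>\<xi>\<close>, which is at least \<open>1 - \<theta>\<close>. So \<open>\<sigma>\<^sub>r\<close> stays away from 0
  (\<open>sigma_bounds_at_jump\<close>). The quadratic form in \<open>IS\<^sub>2\<close> has
  discriminant \<open>- (13/3) (1 - c\<^sub>1)\<^sup>2\<close>, and the degeneration at \<open>c\<^sub>1 = 1\<close> is cancelled by the
  prefactor \<open>1 / c\<^sub>2\<^sup>2 \<ge> 1 / (1 - c\<^sub>1)\<^sup>2\<close>. Therefore
  \<open>IS\<^sub>2 \<ge> (13/40) \<sigma>\<^sub>r\<^sup>2\<close> uniformly in the weights (\<open>IS_2_lower_bound\<close>), and \<open>\<alpha>\<^sub>2\<close> is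
  bounded.\<close>

section \<open>One-sided limits and averages of piecewise smooth functions\<close>

text \<open>Filling in the two one-sided limits makes \<open>f\<close> continuous on the closed interval. This
  gives integrability, and the mean value theorem becomes available up to the ends.\<close>

lemma bounded_derivative_one_sided_limits:
  fixes f f' :: "real \<Rightarrow> real"
  assumes ab: "a < b"
    and deriv: "\<And>x. a < x \<Longrightarrow> x < b \<Longrightarrow> (f has_real_derivative f' x) (at x)"
    and bound: "\<And>x. a < x \<Longrightarrow> x < b \<Longrightarrow> \<bar>f' x\<bar> \<le> M"
    and lima: "(f \<longlongrightarrow> l) (at_right a)" and limb: "(f \<longlongrightarrow> r) (at_left b)"
  shows "f integrable_on {a..b}"
    and "\<And>x. a < x \<Longrightarrow> x < b \<Longrightarrow> \<bar>f x - l\<bar> \<le> M * (b - a)"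
    and "\<And>x. a < x \<Longrightarrow> x < b \<Longrightarrow> \<bar>f x - r\<bar> \<le> M * (b - a)"
proof -
  define g where "g x = (if x \<le> a then l else if b \<le> x then r else f x)" for x
  have g_eq: "g x = f x" if "a < x" "x < b" for x
    using that by (simp add: g_def)
  have g_deriv: "(g has_real_derivative f' x) (at x)" if "a < x" "x < b" for x
    using deriv[OF that]
    by (rule has_field_derivative_transform_within_open[where S = "{a<..<b}"])
       (use that g_eq in auto)
  have cont: "continuous_on {a..b} g"
  proof (rule continuous_on_IccI)
    have "\<forall>\<^sub>F x in at_right a. f x = g x"
      using eventually_at_right_less eventually_at_right_real[OF ab]
      by eventually_elim (auto simp: g_eq)
    then have "(g \<longlongrightarrow> l) (at_right a)"
      using lima by (rule Lim_transform_eventually[rotated])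
    then show "(g \<longlongrightarrow> g a) (at_right a)"
      by (simp add: g_def)
    have "\<forall>\<^sub>F x in at_left b. f x = g x"
      using eventually_at_left_real[OF ab] by eventually_elim (auto simp: g_eq)
    then have "(g \<longlongrightarrow> r) (at_left b)"
      using limb by (rule Lim_transform_eventually[rotated])
    then show "(g \<longlongrightarrow> g b) (at_left b)"
      using ab by (simp add: g_def)
    show "(g \<longlongrightarrow> g x) (at x)" if "a < x" "x < b" for x
      using DERIV_isCont[OF g_deriv[OF that]] by (simp add: isCont_def)
  qed (rule ab)
  have mvt: "\<bar>g y - g x\<bar> \<le> M * (b - a)" if "a \<le> x" "x < y" "y \<le> b" for x y
  proof -
    have "continuous_on {x..y} g"
      using cont by (rule continuous_on_subset) (use that in auto)
    moreover have "g differentiable (at z)" if "x < z" "z < y" for z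
      using g_deriv[of z] that \<open>a \<le> x\<close> \<open>y \<le> b\<close> real_differentiable_def by fastforce
    ultimately obtain d z where z: "x < z" "z < y" "DERIV g z :> d" "g y - g x = (y - x) * d"
      using MVT[OF \<open>x < y\<close>, of g] by blast
    have "d = f' z"
      using DERIV_unique[OF z(3) g_deriv] z that by auto
    then have d: "\<bar>d\<bar> \<le> M"
      using bound[of z] z that by auto
    have "\<bar>g y - g x\<bar> = (y - x) * \<bar>d\<bar>"
      using z that by (simp add: abs_mult)
    also have "\<dots> \<le> (b - a) * M"
      using d that by (intro mult_mono) auto
    finally show ?thesis by (simp add: mult.commute)
  qed
  show "f integrable_on {a..b}"
  proof (rule integrable_spike_finite)
    show "g integrable_on {a..b}"
      using cont by (rule integrable_continuous_real)
    show "finite {a, b}" by simp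
    show "f x = g x" if "x \<in> {a..b} - {a, b}" for x
      using that g_eq[of x] by auto
  qed
  show "\<bar>f x - l\<bar> \<le> M * (b - a)" if "a < x" "x < b" for x
    using mvt[of a x] that g_eq[of x] by (simp add: g_def)
  show "\<bar>f x - r\<bar> \<le> M * (b - a)" if "a < x" "x < b" for x
    using mvt[of x b] that g_eq[of x] ab by (simp add: g_def abs_minus_commute)
qed

lemma integral_near_constant:
  fixes f :: "real \<Rightarrow> real"
  assumes int: "f integrable_on {a..b}" and sub: "a \<le> s" "s \<le> t" "t \<le> b"
    and near: "\<And>x. a < x \<Longrightarrow> x < b \<Longrightarrow> \<bar>f x - l\<bar> \<le> B" and "0 \<le> B"
  shows "\<bar>integral {s..t} f - l * (t - s)\<bar> \<le> B * (t - s)"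
proof -
  have "f integrable_on {s..t}"
    using int by (rule integrable_on_subinterval) (use sub in auto)
  then have "((\<lambda>x. f x - l) has_integral integral {s..t} f - l * (t - s)) {s..t}"
    using has_integral_const_real[of l s t] sub
    by (intro has_integral_diff) (auto simp: mult.commute)
  then have "norm (integral {s..t} f - l * (t - s)) \<le> B * measure lborel {s..t}"
    by (rule has_integral_bound_real[OF \<open>0 \<le> B\<close>, of "{a, b}", rotated])
       (use near sub in auto)
  then show ?thesis using sub by simp
qed

section \<open>Differences of cell averages at a jump\<close>

lemma cell_eqs:
  "cell x0 h (1/2) = {x0..x0 + h}"
  "cell x0 h (3/2) = {x0 + h..x0 + 2 * h}"
  "cell x0 h (5/2) = {x0 + 2 * h..x0 + 3 * h}"
  by (simp_all add: cell_def grid_pt_def algebra_simps)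

text \<open>Up to \<open>O(h)\<close> the first two averages equal the left limit at the jump. The third
  mixes both limits in proportion to the lengths of the two parts of the cell, so that
  \<open>\<sigma>\<^sub>r\<close> sees the fraction of the jump that corresponds to the part right of \<open>\<xi>\<close>.\<close>

lemma sigma_bounds_at_jump:
  fixes u u' :: "real \<Rightarrow> real"
  assumes h: "0 < h" and \<xi>: "x0 + 2 * h \<le> \<xi>" "\<xi> < x0 + 3 * h"
    and deriv: "\<And>x. x \<in> {x0..x0 + 3 * h} - {\<xi>} \<Longrightarrow>
      (u has_real_derivative u' x) (at x within {x0..x0 + 3 * h} - {\<xi>})"
    and bound: "\<And>x. x \<in> {x0..x0 + 3 * h} - {\<xi>} \<Longrightarrow> \<bar>u' x\<bar> \<le> M"
    and jump: "has_jump u \<xi> \<Delta>"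
  shows "\<bar>sigma_l u x0 h\<bar> \<le> 6 * M * h"
    and "\<bar>sigma_r u x0 h - \<Delta> * ((x0 + 3 * h - \<xi>) / h)\<bar> \<le> 6 * M * h"
proof -
  let ?b = "x0 + 3 * h"
  obtain l r where l: "(u \<longlongrightarrow> l) (at_left \<xi>)" and r: "(u \<longlongrightarrow> r) (at_right \<xi>)" and \<Delta>: "r - l = \<Delta>"
    using jump by (auto simp: has_jump_def)
  have x0\<xi>: "x0 < \<xi>" using h \<xi> by linarith
  have deriv_at: "(u has_real_derivative u' x) (at x)"
    if "x0 < x" "x < ?b" "x \<noteq> \<xi>" for x
  proof -
    have "at x within {x0<..<?b} - {\<xi>} = at x"
      using that by (intro at_within_open open_Diff) auto
    moreover have "(u has_real_derivative u' x) (at x within {x0<..<?b} - {\<xi>})"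
      by (rule has_field_derivative_subset[OF deriv]) (use that in auto)
    ultimately show ?thesis by simp
  qed
  have "(u \<longlongrightarrow> u x0) (at x0 within {x0..?b} - {\<xi>})"
    using deriv[of x0] x0\<xi> h
    by (simp add: continuous_within[symmetric] DERIV_continuous)
  then have "(u \<longlongrightarrow> u x0) (at x0 within {x0..x0 + h})"
    by (rule tendsto_within_subset) (use h \<xi> in auto)
  then have start: "(u \<longlongrightarrow> u x0) (at_right x0)"
    using h by (simp add: at_within_Icc_at_right)
  have "(u \<longlongrightarrow> u ?b) (at ?b within {x0..?b} - {\<xi>})"
    using deriv[of ?b] \<xi> h
    by (simp add: continuous_within[symmetric] DERIV_continuous)
  then have "(u \<longlongrightarrow> u ?b) (at ?b within {(\<xi> + ?b) / 2..?b})"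
    by (rule tendsto_within_subset) (use x0\<xi> \<xi> in auto)
  then have stop: "(u \<longlongrightarrow> u ?b) (at_left ?b)"
    using \<xi> by (simp add: at_within_Icc_at_left)
  have M: "0 \<le> M"
    using bound[of x0] x0\<xi> h by force
  have left: "u integrable_on {x0..\<xi>}"
    "\<And>x. x0 < x \<Longrightarrow> x < \<xi> \<Longrightarrow> \<bar>u x - l\<bar> \<le> M * (\<xi> - x0)"
    using bounded_derivative_one_sided_limits[OF x0\<xi> _ _ start l, of u' M]
      deriv_at bound \<xi> by force+
  have right: "u integrable_on {\<xi>..?b}"
    "\<And>x. \<xi> < x \<Longrightarrow> x < ?b \<Longrightarrow> \<bar>u x - r\<bar> \<le> M * (?b - \<xi>)"
    using bounded_derivative_one_sided_limits[OF \<xi>(2) _ _ r stop, of u' M]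
      deriv_at bound x0\<xi> by force+
  have left': "\<bar>u x - l\<bar> \<le> M * (3 * h)" if "x0 < x" "x < \<xi>" for x
    using left(2)[OF that] mult_left_mono[of "\<xi> - x0" "3 * h" M] M \<xi> by linarith
  have right': "\<bar>u x - r\<bar> \<le> M * (3 * h)" if "\<xi> < x" "x < ?b" for x
    using right(2)[OF that] mult_left_mono[of "?b - \<xi>" "3 * h" M] M x0\<xi> by linarith
  have Mh: "0 \<le> M * (3 * h)" using M h by simp
  note int_left = integral_near_constant[OF left(1) _ _ _ left' Mh]
  note int_right = integral_near_constant[OF right(1) _ _ _ right' Mh]
  define A1 A2 A3 A4 where "A1 = integral {x0..x0 + h} u"
    and "A2 = integral {x0 + h..x0 + 2 * h} u"
    and "A3 = integral {x0 + 2 * h..\<xi>} u" and "A4 = integral {\<xi>..?b} u"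
  define t where "t = ?b - \<xi>"
  have A1: "\<bar>A1 - l * h\<bar> \<le> M * (3 * h) * h"
    using int_left[of x0 "x0 + h"] h \<xi> by (simp add: A1_def)
  have A2: "\<bar>A2 - l * h\<bar> \<le> M * (3 * h) * h"
    using int_left[of "x0 + h" "x0 + 2 * h"] h \<xi> by (simp add: A2_def)
  have A3: "\<bar>A3 - l * (h - t)\<bar> \<le> M * (3 * h) * (h - t)"
    using int_left[of "x0 + 2 * h" \<xi>] h \<xi> by (simp add: A3_def t_def algebra_simps)
  have A4: "\<bar>A4 - r * t\<bar> \<le> M * (3 * h) * t"
    using int_right[of \<xi> ?b] \<xi> by (simp add: A4_def t_def)
  have "integral {x0 + 2 * h..?b} u = A3 + A4"
    unfolding A3_def A4_def
  proof (rule Henstock_Kurzweil_Integration.integral_combine[symmetric])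
    have "u integrable_on {x0..?b}"
      using Henstock_Kurzweil_Integration.integrable_combine[OF _ _ left(1) right(1)] x0\<xi> \<xi>
      by simp
    then show "u integrable_on {x0 + 2 * h..?b}"
      by (rule integrable_on_subinterval) (use h in auto)
  qed (use \<xi> in auto)
  then have sl: "sigma_l u x0 h = (A2 - A1) / h" and sr: "sigma_r u x0 h = (A3 + A4 - A2) / h"
    by (simp_all add: sigma_l_def sigma_r_def cell_avg_def cell_eqs A1_def A2_def diff_divide_distrib)
  have div_le: "\<bar>X / h\<bar> \<le> 6 * M * h" if "\<bar>X\<bar> \<le> 6 * M * h * h" for X
    using that h by (simp add: divide_le_eq)
  have "\<bar>A2 - A1\<bar> \<le> 6 * M * h * h"
    using A1 A2 by linarith
  then show "\<bar>sigma_l u x0 h\<bar> \<le> 6 * M * h"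
    unfolding sl by (rule div_le)
  have "M * (3 * h) * (h - t) + M * (3 * h) * t = M * (3 * h) * h"
    by (simp add: algebra_simps)
  moreover have "A3 + A4 - A2 - \<Delta> * t = (A3 - l * (h - t)) + (A4 - r * t) - (A2 - l * h)"
    by (simp add: \<Delta>[symmetric] algebra_simps)
  ultimately have "\<bar>A3 + A4 - A2 - \<Delta> * t\<bar> \<le> 6 * M * h * h"
    using A2 A3 A4 by linarith
  then have "\<bar>(A3 + A4 - A2 - \<Delta> * t) / h\<bar> \<le> 6 * M * h"
    by (rule div_le)
  then show "\<bar>sigma_r u x0 h - \<Delta> * ((x0 + 3 * h - \<xi>) / h)\<bar> \<le> 6 * M * h"
    by (simp add: sr t_def[symmetric] diff_divide_distrib)
qed

section \<open>Lower bound for the smoothness indicator\<close>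

text \<open>With \<open>d\<close> the coefficient of \<open>\<sigma>\<^sub>l\<^sup>2\<close>, completing the square gives
  \<open>4 d Q = (13/3) (1 - c\<^sub>1)\<^sup>2 \<sigma>\<^sub>r\<^sup>2 + (2 d \<sigma>\<^sub>l + (c\<^sub>1 - 11/3) \<sigma>\<^sub>r)\<^sup>2\<close>
  for the quadratic form \<open>Q\<close> in \<open>IS\<^sub>2\<close>. Here \<open>0 < d \<le> 10/3\<close>, and \<open>c\<^sub>2 \<le> 1 - c\<^sub>1\<close> absorbs the
  factor \<open>(1 - c\<^sub>1)\<^sup>2\<close>.\<close>

lemma IS_2_lower_bound:
  assumes "0 \<le> c 1" "0 < c 2" "c 1 + c 2 \<le> 1"
  shows "13/40 * (sigma_r u x0 h)\<^sup>2 \<le> IS c u x0 h 2"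
proof -
  define a s l where "a = c 1" and "s = sigma_r u x0 h" and "l = sigma_l u x0 h"
  define d Q where "d = 10/3 - 3 * a + a\<^sup>2"
    and "Q = 4/3 * s\<^sup>2 + (a - 11/3) * s * l + d * l\<^sup>2"
  have a: "0 \<le> a" "a \<le> 1" "c 2 \<le> 1 - a"
    using assms by (auto simp: a_def)
  have "a\<^sup>2 \<le> a" using a by (simp add: power2_eq_square mult_left_le)
  then have "d \<le> 10/3"
    using a by (simp add: d_def)
  moreover have "d = (a - 3/2)\<^sup>2 + 13/12"
    by (simp add: d_def power2_eq_square algebra_simps)
  then have "0 < d"
    by (simp add: add_nonneg_pos)
  ultimately have d: "0 < d" "d \<le> 10/3"
    by simp_all
  have "4 * d * Q = 13/3 * ((1 - a) * s)\<^sup>2 + (2 * d * l + (a - 11/3) * s)\<^sup>2"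
    unfolding Q_def d_def by (simp add: power2_eq_square algebra_simps)
  then have "13/3 * ((1 - a) * s)\<^sup>2 \<le> 4 * d * Q"
    by simp
  moreover from this have "0 \<le> 4 * d * Q"
    by (rule order_trans[rotated]) simp
  then have "0 \<le> Q"
    using d by (simp add: zero_le_mult_iff)
  then have "4 * d * Q \<le> 40/3 * Q"
    using d by (intro mult_right_mono) auto
  moreover have "(c 2 * s)\<^sup>2 \<le> ((1 - a) * s)\<^sup>2"
    using a assms unfolding power_mult_distrib by (intro mult_right_mono power_mono) auto
  ultimately have "13/40 * (c 2 * s)\<^sup>2 \<le> Q"
    by linarith
  moreover have "IS c u x0 h 2 = Q / (c 2)\<^sup>2"
    by (simp add: IS_def Let_def Q_def d_def a_def s_def l_def)
  ultimately show ?thesis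
    using assms by (simp add: s_def[symmetric] pos_le_divide_eq power_mult_distrib mult_ac)
qed

section \<open>Orders of the weights\<close>

text \<open>Everything follows from \<open>\<omega>\<^sub>i \<le> \<alpha>\<^sub>i / \<alpha>\<^sub>1\<close>. The factor \<open>L\<close> expresses that \<open>\<epsilon>\<close> has the
  same order as \<open>\<epsilon> + IS\<^sub>1\<close>, so that the powers of \<open>\<epsilon>\<close> cancel in \<open>\<alpha>\<^sub>0 / \<alpha>\<^sub>1\<close>; in
  \<open>\<alpha>\<^sub>2 / \<alpha>\<^sub>1\<close> the denominator of \<open>\<alpha>\<^sub>2\<close> stays above \<open>m ^ p\<close>, and a factor \<open>\<epsilon> ^ p\<close> is gained.\<close>

lemma omega_bounds:
  assumes c: "\<And>i. i \<in> {0,1,2} \<Longrightarrow> 0 < c i" and c2: "c 2 \<le> 1"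
    and eps: "0 < eps" and m: "0 < m" "m \<le> IS c u x0 h 2"
    and L: "eps + (sigma_l u x0 h)\<^sup>2 \<le> L * eps"
  shows "\<bar>omega c eps p u x0 h 0\<bar> \<le> L ^ p * (c 0 / c 1)"
    and "\<bar>omega c eps p u x0 h 1\<bar> \<le> 1"
    and "\<bar>omega c eps p u x0 h 2\<bar> \<le> (L / m) ^ p * (eps ^ p / c 1)"
proof -
  define A where "A = alpha c eps p u x0 h"
  have IS: "IS c u x0 h 0 = 0" "IS c u x0 h 1 = (sigma_l u x0 h)\<^sup>2"
    by (simp_all add: IS_def)
  have c_pos: "0 < c 0" "0 < c 1" "0 < c 2" using c by auto
  have e1: "0 < eps + (sigma_l u x0 h)\<^sup>2"
    using eps by (simp add: add_pos_nonneg)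
  have A0: "A 0 = c 0 / eps ^ p"
    and A1: "A 1 = c 1 / (eps + (sigma_l u x0 h)\<^sup>2) ^ p"
    by (simp_all add: A_def alpha_def IS[unfolded One_nat_def])
  have pos: "0 < A 0" "0 < A 1" "0 < A 2"
    unfolding A0 A1 using c_pos e1 eps m by (simp_all add: A_def alpha_def)
  have om: "omega c eps p u x0 h i = A i / (A 0 + A 1 + A 2)" for i
    by (simp add: omega_def A_def)
  have le: "A i / (A 0 + A 1 + A 2) \<le> A i / A 1" if "0 < A i" for i
    using pos that by (intro divide_left_mono) auto
  have abs: "\<bar>omega c eps p u x0 h i\<bar> \<le> A i / A 1" if "i \<in> {0,1,2}" for i
  proof -
    have "0 < A i" using that pos by auto
    then show ?thesis using le[of i] pos by (simp add: om)
  qed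
  have L_pow: "(eps + (sigma_l u x0 h)\<^sup>2) ^ p \<le> (L * eps) ^ p"
    using L e1 by (intro power_mono) auto
  have ratio: "A i / A 1 \<le> a * (L * eps) ^ p / c 1" if "A i \<le> a" "0 < A i" for i a
  proof -
    have "A i / A 1 = A i * (eps + (sigma_l u x0 h)\<^sup>2) ^ p / c 1"
      unfolding A1 by simp
    also have "\<dots> \<le> a * (L * eps) ^ p / c 1"
      using that L_pow c_pos e1 by (intro divide_right_mono mult_mono) auto
    finally show ?thesis .
  qed
  have "\<bar>omega c eps p u x0 h 0\<bar> \<le> A 0 * (L * eps) ^ p / c 1"
    using abs[of 0] ratio[of 0 "A 0"] pos by simp
  also have "\<dots> = L ^ p * (c 0 / c 1)"
    using eps by (simp add: A0 power_mult_distrib)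
  finally show "\<bar>omega c eps p u x0 h 0\<bar> \<le> L ^ p * (c 0 / c 1)" .
  show "\<bar>omega c eps p u x0 h 1\<bar> \<le> 1"
    using abs[of 1] pos by simp
  have "A 2 \<le> 1 / m ^ p"
    unfolding A_def alpha_def using c_pos c2 m eps
    by (intro frac_le power_mono) auto
  then have "\<bar>omega c eps p u x0 h 2\<bar> \<le> 1 / m ^ p * (L * eps) ^ p / c 1"
    using abs[of 2] ratio[of 2 "1 / m ^ p"] pos by simp
  also have "\<dots> = (L / m) ^ p * (eps ^ p / c 1)"
    by (simp add: power_mult_distrib power_divide)
  finally show "\<bar>omega c eps p u x0 h 2\<bar> \<le> (L / m) ^ p * (eps ^ p / c 1)" .
qed

lemma derivs_on_imp_deriv:
  assumes "derivs_on D u S" "x \<in> S"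
  shows "(u has_real_derivative D 1 x) (at x within S)"
proof (rule has_field_derivative_transform_within[where d = 1])
  show "(D 0 has_real_derivative D 1 x) (at x within S)"
    using assms by (auto simp: derivs_on_def)
qed (use assms in \<open>auto simp: derivs_on_def\<close>)

theorem theorem3p2:
  fixes u :: "real \<Rightarrow> real \<Rightarrow> real" and x0 \<xi> :: "real \<Rightarrow> real"
    and c :: "real \<Rightarrow> nat \<Rightarrow> real" and \<omega> :: "nat \<Rightarrow> real \<Rightarrow> real"
    and \<Delta>u \<theta> K K0 K1 \<gamma>0 \<gamma>1 q :: real and p :: nat
  assumes smooth_S1:
      "smooth_family_on (\<lambda>h. cell (x0 h) h (1/2) \<union> cell (x0 h) h (3/2)) u"
    and single_discontinuity:
      "smooth_family_on
         (\<lambda>h. (cell (x0 h) h (1/2) \<union> cell (x0 h) h (3/2) \<union> cell (x0 h) h (5/2)) - {\<xi> h}) u"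
    and discontinuity:
      "\<forall>\<^sub>F h in at_right 0. \<xi> h \<in> cell (x0 h) h (5/2) \<and> has_jump (u h) (\<xi> h) \<Delta>u"
    and jump_nonzero: "\<Delta>u \<noteq> 0"
    and off_right_end: "\<theta> < 1" "\<forall>\<^sub>F h in at_right 0. \<xi> h \<le> grid_pt (x0 h) h 2 + \<theta> * h"
    and params: "K > 0" "q > 0" "K0 > 0" "K1 > 0" "\<gamma>0 \<ge> 0" "\<gamma>1 \<ge> 0" "\<gamma>0 \<ge> \<gamma>1"
    and c0: "\<And>h. h > 0 \<Longrightarrow> c h 0 = K0 * h powr \<gamma>0"
    and c1: "\<And>h. h > 0 \<Longrightarrow> c h 1 = K1 * h powr \<gamma>1"
    and c2: "\<And>h. h > 0 \<Longrightarrow> c h 2 = 1 - K0 * h powr \<gamma>0 - K1 * h powr \<gamma>1"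
    and c_pos: "\<forall>\<^sub>F h in at_right 0. \<forall>i\<in>{0,1,2}. c h i > 0"
    and omega: "\<And>i h. i \<in> {0,1,2} \<Longrightarrow> h > 0 \<Longrightarrow>
      \<omega> i h = omega (c h) (K * h powr q) p (u h) (x0 h) h i"
    and pq: "real p * q \<ge> \<gamma>1" and q2: "q \<le> 2"
  shows "(\<omega> 0 \<in> O[at_right 0](\<lambda>h. h powr (\<gamma>0 - \<gamma>1)) \<and>
          \<omega> 1 \<in> O[at_right 0](\<lambda>h. 1) \<and>
          \<omega> 2 \<in> O[at_right 0](\<lambda>h. h powr (real p * q - \<gamma>1))) \<and>
         (\<gamma>0 \<ge> 1 + \<gamma>1 \<longrightarrow> real p * q \<ge> 2 + \<gamma>1 \<longrightarrow>
          \<omega> 0 \<in> O[at_right 0](\<lambda>h. h) \<and>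
          \<omega> 1 \<in> O[at_right 0](\<lambda>h. 1) \<and>
          \<omega> 2 \<in> O[at_right 0](\<lambda>h. h\<^sup>2))"
proof -
  define S where "S h = {x0 h..x0 h + 3 * h} - {\<xi> h}" for h
  obtain D where D: "\<forall>\<^sub>F h in at_right 0. derivs_on (D h) (u h)
        ((cell (x0 h) h (1/2) \<union> cell (x0 h) h (3/2) \<union> cell (x0 h) h (5/2)) - {\<xi> h})"
    and bounded: "\<forall>k. \<exists>M. \<forall>\<^sub>F h in at_right 0. \<forall>x\<in>(cell (x0 h) h (1/2) \<union>
        cell (x0 h) h (3/2) \<union> cell (x0 h) h (5/2)) - {\<xi> h}. \<bar>D h k x\<bar> \<le> M"
    using single_discontinuity unfolding smooth_family_on_def by (elim exE conjE) (rule that)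
  obtain M where M: "\<forall>\<^sub>F h in at_right 0. \<forall>x\<in>(cell (x0 h) h (1/2) \<union>
        cell (x0 h) h (3/2) \<union> cell (x0 h) h (5/2)) - {\<xi> h}. \<bar>D h 1 x\<bar> \<le> M"
    using spec[OF bounded, of 1] by (elim exE) (rule that)
  define C where "C = 6 * M"
  \<comment> \<open>\<open>\<sigma>\<^sub>r\<close> sees at least \<open>2 * \<delta>\<close> of the jump; half of it is given up to the error \<open>C * h\<close>\<close>
  define \<delta> where "\<delta> = \<bar>\<Delta>u\<bar> * (1 - \<theta>) / 2"
  define m where "m = 13/40 * \<delta>\<^sup>2"
  define L where "L = 1 + C\<^sup>2 / K"
  have \<delta>: "0 < \<delta>" using jump_nonzero off_right_end(1) by (simp add: \<delta>_def)
  then have m: "0 < m" by (simp add: m_def)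
  have "((\<lambda>h. C * h) \<longlongrightarrow> C * 0) (at_right (0::real))"
    by (intro tendsto_intros)
  then have small: "\<forall>\<^sub>F h in at_right 0. C * h < \<delta>"
    using \<delta> by (intro order_tendstoD(2)) auto
  have pos: "\<forall>\<^sub>F h::real in at_right 0. 0 < h \<and> h < 1"
    using eventually_at_right_real[of 0 1] by simp
  have bounds: "\<forall>\<^sub>F h in at_right 0. 0 < h \<and> h < 1 \<and>
      \<bar>\<omega> 0 h\<bar> \<le> L ^ p * (K0 / K1) * h powr (\<gamma>0 - \<gamma>1) \<and> \<bar>\<omega> 1 h\<bar> \<le> 1 \<and>
      \<bar>\<omega> 2 h\<bar> \<le> (L / m) ^ p * (K ^ p / K1) * h powr (real p * q - \<gamma>1)"
    using D M small pos discontinuity off_right_end(2) c_pos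
  proof eventually_elim
    case (elim h)
    then have h: "0 < h" "h < 1" by auto
    have S: "(cell (x0 h) h (1/2) \<union> cell (x0 h) h (3/2) \<union> cell (x0 h) h (5/2)) - {\<xi> h} = S h"
      using h by (auto simp: cell_eqs S_def)
    have "\<theta> * h < h" using off_right_end(1) h by simp
    then have \<xi>: "x0 h + 2 * h \<le> \<xi> h" "\<xi> h < x0 h + 3 * h"
      and \<xi>\<theta>: "\<xi> h \<le> x0 h + 2 * h + \<theta> * h"
      using elim(5,6) by (auto simp: cell_eqs grid_pt_def)
    have deriv: "(u h has_real_derivative D h 1 x) (at x within S h)" if "x \<in> S h" for x
      using derivs_on_imp_deriv elim(1) that unfolding S by blast
    have bound: "\<bar>D h 1 x\<bar> \<le> M" if "x \<in> S h" for x
      using elim(2) that unfolding S by blast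
    note sig = sigma_bounds_at_jump[OF h(1) \<xi> deriv[unfolded S_def] bound[unfolded S_def]
        conjunct2[OF elim(5)], folded C_def]
    define right_part where "right_part = (x0 h + 3 * h - \<xi> h) / h"
    have "1 - \<theta> \<le> right_part"
      unfolding right_part_def pos_le_divide_eq[OF h(1)] using \<xi>\<theta> by (simp add: algebra_simps)
    then have "2 * \<delta> \<le> \<bar>\<Delta>u * right_part\<bar>"
      using off_right_end(1) by (simp add: \<delta>_def abs_mult mult_left_mono)
    then have "\<delta> \<le> \<bar>sigma_r (u h) (x0 h) h\<bar>"
      using sig(2)[folded right_part_def] elim(3) by linarith
    then have "\<delta>\<^sup>2 \<le> (sigma_r (u h) (x0 h) h)\<^sup>2"
      using \<delta> by (simp add: abs_le_square_iff[symmetric])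
    moreover have c: "0 < c h 0" "0 < c h 1" "0 < c h 2" using elim(7) by auto
    moreover have "c h 0 + c h 1 + c h 2 = 1"
      using h c0 c1 c2 by simp
    ultimately have IS2: "m \<le> IS (c h) (u h) (x0 h) h 2"
      using IS_2_lower_bound[of "c h" "u h" "x0 h" h] by (simp add: m_def)
    have "c h 2 \<le> 1" using \<open>c h 0 + c h 1 + c h 2 = 1\<close> c by linarith
    have "(sigma_l (u h) (x0 h) h)\<^sup>2 \<le> (C * h)\<^sup>2"
      using power_mono[OF sig(1), of 2] by simp
    also have "\<dots> = C\<^sup>2 * h powr 2"
      using h by (simp add: power_mult_distrib)
    also have "\<dots> \<le> C\<^sup>2 * h powr q"
      using h q2 by (intro mult_left_mono powr_mono') auto
    also have "\<dots> = C\<^sup>2 / K * (K * h powr q)"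
      using params by simp
    finally have L: "K * h powr q + (sigma_l (u h) (x0 h) h)\<^sup>2 \<le> L * (K * h powr q)"
      by (simp add: L_def ring_distribs)
    have eps: "0 < K * h powr q" using params h by simp
    note om = omega_bounds[where p = p, OF elim(7)[rule_format] \<open>c h 2 \<le> 1\<close> eps m IS2 L]
    have "\<bar>\<omega> 0 h\<bar> \<le> L ^ p * (c h 0 / c h 1)"
      using om(1) omega[of 0 h] h by simp
    also have "\<dots> = L ^ p * (K0 / K1) * h powr (\<gamma>0 - \<gamma>1)"
      using h c0 c1 by (simp add: powr_diff)
    finally have "\<bar>\<omega> 0 h\<bar> \<le> L ^ p * (K0 / K1) * h powr (\<gamma>0 - \<gamma>1)" .
    moreover have "\<bar>\<omega> 1 h\<bar> \<le> 1"
      using om(2) omega[of 1 h] h by simp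
    moreover have "(K * h powr q) ^ p / c h 1 = K ^ p / K1 * h powr (real p * q - \<gamma>1)"
      using h c1 by (simp add: powr_diff power_mult_distrib powr_power mult.commute)
    then have "\<bar>\<omega> 2 h\<bar> \<le> (L / m) ^ p * (K ^ p / K1 * h powr (real p * q - \<gamma>1))"
      using om(3) omega[of 2 h] h by auto
    ultimately show ?case
      using h by (auto simp: mult.assoc)
  qed
  have O0: "\<omega> 0 \<in> O[at_right 0](\<lambda>h. h powr (\<gamma>0 - \<gamma>1))"
    by (rule bigoI[where c = "L ^ p * (K0 / K1)"], rule eventually_mono[OF bounds]) auto
  have O1: "\<omega> 1 \<in> O[at_right 0](\<lambda>h. 1)"
    by (rule bigoI[where c = 1], rule eventually_mono[OF bounds]) auto
  have O2: "\<omega> 2 \<in> O[at_right 0](\<lambda>h. h powr (real p * q - \<gamma>1))"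
    by (rule bigoI[where c = "(L / m) ^ p * (K ^ p / K1)"], rule eventually_mono[OF bounds]) auto
  have powr_bigo: "(\<lambda>h. h powr a) \<in> O[at_right 0](\<lambda>h. h ^ n)" if "real n \<le> a" for a :: real and n :: nat
  proof (rule bigoI[where c = 1], rule eventually_mono[OF pos])
    fix h :: real
    assume "0 < h \<and> h < 1"
    then show "norm (h powr a) \<le> 1 * norm (h ^ n)"
      using powr_mono'[OF that, of h] by (simp add: powr_realpow)
  qed
  have "\<omega> 0 \<in> O[at_right 0](\<lambda>h. h)" if "\<gamma>0 \<ge> 1 + \<gamma>1"
    using landau_o.big_trans[OF O0 powr_bigo[of 1]] that by simp
  moreover have "\<omega> 2 \<in> O[at_right 0](\<lambda>h. h\<^sup>2)" if "real p * q \<ge> 2 + \<gamma>1"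
    using landau_o.big_trans[OF O2 powr_bigo[of 2]] that by simp
  ultimately show ?thesis
    using O0 O1 O2 by blast
qed

end
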